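(* Let $G$ be a locally finite connected graph (possibly infinite) and let $\mathcal{E}$ be a finitely bounded set of tight entanglements in $G$. Then the set of $\mathcal{E}$-friendly separations of $G$ is nested.
   Context: A separation of a graph $G$ is a set $\{A,B\}$ with $A\cup B=V(G)$ such that $G$ has no edge between $A\setminus B$ and $B\setminus A$; its order is $|A\cap B|$; it is proper if $A\setminus B,B\setminus A\neq\emptyset$. Two separations $\{A,B\},\{C,D\}$ are nested if, after possibly renaming sides, $A\subseteq C$ and $B\supseteq D$; otherwise they cross. A set of separations is nested if its elements are pairwise nested. For crossing $\{A,B\},\{C,D\}$ the four corners are $\{A\cap C,B\cup D\}$, $\{A\cap D,B\cup C\}$, $\{B\cap D,A\cup C\}$, $\{B\cap C,A\cup D\}$; the first two lie on the same side of $\{A,B\}$, as do the last two. An entanglement in $G$ is a non-empty set $\varepsilon$ of proper separations such that: if $\{A,B\}\in\varepsilon$ is crossed by a separation of $G$ so that two corners lying on the same side of $\{A,B\}$ have order at most $|A\cap B|$, then at least one of them has order equal to $|A\cap B|$ and lies in $\varepsilon$. A separation $\{A,B\}$ is tight if there are components $C_A\subseteq G[A\setminus B]$ and $C_B\subseteq G[B\setminus A]$ of $G-(A\cap B)$ with $N_G(C_A)=A\cap B=N_G(C_B)$; an entanglement is tight if all its separations are tight. A set $\mathcal{E}$ of entanglements is finitely bounded if there is $k\in\mathbb{N}$ with $|A\cap B|\le k$ for all $\{A,B\}\in\bigcup\mathcal{E}$. A separation $s$ is $\mathcal{E}$-friendly if it lies in some $\varepsilon\in\mathcal{E}$ such that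 no other separation in $\varepsilon$ crosses fewer separations in $\bigcup\mathcal{E}$ than $s$ does. *)

theory Defs
  imports "Graph_Theory.Graph_Theory" "HOL-Library.Equipollence"
begin

text \<open>
  Following Graph_Theory, an undirected simple graph, finite or infinite, is a symmetric loopfree
  digraph whose arcs are pairs of vertices, that is, a \<^locale>\<open>pair_bidirected_digraph\<close>.
\<close>

definition locally_finite :: "'a pair_pre_digraph \<Rightarrow> bool" where
  "locally_finite G \<longleftrightarrow> (\<forall>v \<in> pverts G. finite (out_arcs G v))"

text \<open>\<open>N\<^sub>G(U)\<close>: the vertices outside \<open>U\<close> with a neighbour in \<open>U\<close>.\<close>

definition neighbourhood :: "'a pair_pre_digraph \<Rightarrow> 'a set \<Rightarrow> 'a set" where
  "neighbourhood G U = {v \<in> pverts G - U. \<exists>u \<in> U. (u, v) \<in> parcs G}"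

text \<open>
  The vertex sets of the components of \<open>G - X\<close>; in a symmetric digraph the components are the
  strongly connected components.
\<close>

definition components_minus :: "'a pair_pre_digraph \<Rightarrow> 'a set \<Rightarrow> 'a set set" where
  "components_minus G X = pre_digraph.sccs_verts (with_proj G \<restriction> (pverts G - X))"

text \<open>
  A separation is the unordered pair \<open>{A, B}\<close> of its sides. Statements about the sides of \<open>S\<close>
  quantify over all \<open>A\<close>, \<open>B\<close> with \<open>S = {A, B}\<close>, so both ways of naming the sides are covered.
\<close>

definition separation :: "'a pair_pre_digraph \<Rightarrow> 'a set set \<Rightarrow> bool" where
  "separation G S \<longleftrightarrow>
     (\<exists>A B. S = {A, B} \<and> A \<union> B = pverts G \<and> (\<forall>u \<in> A - B. \<forall>v \<in> B - A. (u, v) \<notin> parcs G))"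

definition proper_separation :: "'a pair_pre_digraph \<Rightarrow> 'a set set \<Rightarrow> bool" where
  "proper_separation G S \<longleftrightarrow>
     separation G S \<and> (\<exists>A B. S = {A, B} \<and> A - B \<noteq> {} \<and> B - A \<noteq> {})"

text \<open>
  The separator \<open>A \<inter> B\<close> of \<open>{A, B}\<close>, whose cardinality is the order. Separations may have infinite
  order, so orders are compared as cardinals, by \<^const>\<open>lepoll\<close> and \<^const>\<open>eqpoll\<close>, rather than by
  \<^const>\<open>card\<close>, which is \<open>0\<close> on infinite sets.
\<close>

definition separator :: "'a set set \<Rightarrow> 'a set" where
  "separator S = \<Inter>S"

lemma separator_pair [simp]: "separator {A, B} = A \<inter> B"
  by (simp add: separator_def)

definition nested :: "'a set set \<Rightarrow> 'a set set \<Rightarrow> bool" where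
  "nested S T \<longleftrightarrow> (\<exists>A B C D. S = {A, B} \<and> T = {C, D} \<and> A \<subseteq> C \<and> D \<subseteq> B)"

text \<open>Meaningful for separations only: sets that are not of the form \<open>{A, B}\<close> are never nested.\<close>

definition crosses :: "'a set set \<Rightarrow> 'a set set \<Rightarrow> bool" where
  "crosses S T \<longleftrightarrow> \<not> nested S T"

text \<open>
  The two corners on the side of \<open>{A, B}\<close> contained in \<open>A\<close> are \<open>{A \<inter> C, B \<union> D}\<close> and
  \<open>{A \<inter> D, B \<union> C}\<close>; those on the side of \<open>B\<close> are obtained by exchanging \<open>A\<close> and \<open>B\<close>, which
  the quantification over \<open>A\<close> and \<open>B\<close> includes.
\<close>

definition entanglement :: "'a pair_pre_digraph \<Rightarrow> 'a set set set \<Rightarrow> bool" where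
  "entanglement G \<epsilon> \<longleftrightarrow>
     \<epsilon> \<noteq> {} \<and> (\<forall>S \<in> \<epsilon>. proper_separation G S) \<and>
     (\<forall>A B C D. {A, B} \<in> \<epsilon> \<and> separation G {C, D} \<and> crosses {A, B} {C, D} \<and>
        separator {A \<inter> C, B \<union> D} \<lesssim> A \<inter> B \<and> separator {A \<inter> D, B \<union> C} \<lesssim> A \<inter> B \<longrightarrow>
        (separator {A \<inter> C, B \<union> D} \<approx> A \<inter> B \<and> {A \<inter> C, B \<union> D} \<in> \<epsilon>) \<or>
        (separator {A \<inter> D, B \<union> C} \<approx> A \<inter> B \<and> {A \<inter> D, B \<union> C} \<in> \<epsilon>))"

definition tight_separation :: "'a pair_pre_digraph \<Rightarrow> 'a set set \<Rightarrow> bool" where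
  "tight_separation G S \<longleftrightarrow> separation G S \<and>
     (\<exists>A B K L. S = {A, B} \<and>
        K \<in> components_minus G (A \<inter> B) \<and> K \<subseteq> A - B \<and> neighbourhood G K = A \<inter> B \<and>
        L \<in> components_minus G (A \<inter> B) \<and> L \<subseteq> B - A \<and> neighbourhood G L = A \<inter> B)"

definition tight_entanglement :: "'a pair_pre_digraph \<Rightarrow> 'a set set set \<Rightarrow> bool" where
  "tight_entanglement G \<epsilon> \<longleftrightarrow> entanglement G \<epsilon> \<and> (\<forall>S \<in> \<epsilon>. tight_separation G S)"

definition finitely_bounded :: "'a set set set set \<Rightarrow> bool" where
  "finitely_bounded \<E> \<longleftrightarrow>
     (\<exists>k::nat. \<forall>S \<in> \<Union>\<E>. finite (separator S) \<and> card (separator S) \<le> k)"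

definition crossing_set :: "'a set set set set \<Rightarrow> 'a set set \<Rightarrow> 'a set set set" where
  "crossing_set \<E> S = {T \<in> \<Union>\<E>. crosses S T}"

text \<open>``Crosses fewer'' is likewise a comparison of cardinals.\<close>

definition friendly :: "'a set set set set \<Rightarrow> 'a set set \<Rightarrow> bool" where
  "friendly \<E> S \<longleftrightarrow>
     (\<exists>\<epsilon> \<in> \<E>. S \<in> \<epsilon> \<and> \<not> (\<exists>T \<in> \<epsilon>. crossing_set \<E> T \<prec> crossing_set \<E> S))"

end

(*
  Every separation in the union of the entanglements is crossed by only finitely many others: if two
  tight separations cross, the separator of one is a minimal separator between two vertices that lie in
  or next to the separator of the other, and there are only finitely many minimal separators of bounded
  size between two given vertices. So crossing numbers are finite, and they are strictly submodular: two
  opposite corners of crossing S, T together cross fewer separations than S and T together do. If S and T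
  are friendly and cross, the entanglement axioms at S and T put corners of the right order into the two
  entanglements, and each of these corners crosses at least as many separations as S or T, respectively;
  comparing orders on all four sides shows that this contradicts submodularity.
*)

theory Submission
  imports Defs
begin

section \<open>Corners and crossing numbers\<close>

lemma nested_pair_iff:
  "nested {A, B} {C, D} \<longleftrightarrow>
     A \<subseteq> C \<and> D \<subseteq> B \<or> A \<subseteq> D \<and> C \<subseteq> B \<or> B \<subseteq> C \<and> D \<subseteq> A \<or> B \<subseteq> D \<and> C \<subseteq> A"
  unfolding nested_def by (auto simp: doubleton_eq_iff)

lemma nested_sym: "nested S T \<Longrightarrow> nested T S"
  unfolding nested_def by (metis insert_commute)

lemma crosses_sym: "crosses S T \<Longrightarrow> crosses T S"
  unfolding crosses_def using nested_sym by blast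

text \<open>If nestedness is witnessed by \<open>A\<close> or \<open>C\<close> lying in a side of
  \<open>{E, F}\<close>, that side contains \<open>A \<inter> C\<close>. Otherwise \<open>B\<close>
  and \<open>D\<close> lie in sides of \<open>{E, F}\<close>. If they lie in the same side, it
  contains \<open>B \<union> D\<close> and the other side lies in \<open>A \<inter> C\<close>. If
  they lie in different sides, \<open>{A, B}\<close> and \<open>{C, D}\<close> would be nested,
  against \<open>crosses\<close>.\<close>

lemma nested_corner:
  assumes "nested {A, B} {E, F}" "nested {C, D} {E, F}" "crosses {A, B} {C, D}"
  shows "nested {A \<inter> C, B \<union> D} {E, F}"
  using assms unfolding crosses_def nested_pair_iff by blast

text \<open>Nestedness puts \<open>A\<close> or \<open>B\<close> inside a side of
  \<open>{E, F}\<close>, and with it one of the two corners. Contrapositively, a separation crossing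
  two opposite corners crosses \<open>{A, B}\<close> and, by symmetry,
  \<open>{C, D}\<close>.\<close>

lemma nested_opposite_corners:
  assumes "nested {A, B} {E, F}"
  shows "nested {A \<inter> C, B \<union> D} {E, F} \<or> nested {B \<inter> D, A \<union> C} {E, F}"
  using assms unfolding nested_pair_iff by blast

lemma separation_pairE:
  assumes "separation G S"
  obtains A B where "S = {A, B}" "A \<union> B = pverts G"
    "\<And>u v. u \<in> A - B \<Longrightarrow> v \<in> B - A \<Longrightarrow> (u, v) \<notin> parcs G"
  using assms unfolding separation_def by blast

text \<open>The strict inequality is due to \<open>{A, B}\<close> itself, which crosses \<open>{C, D}\<close> but no corner.\<close>

lemma card_crossing_set_opposite_corners:
  assumes seps: "\<And>S. S \<in> \<Union>\<E> \<Longrightarrow> separation G S"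
    and S: "{A, B} \<in> \<Union>\<E>" and cross: "crosses {A, B} {C, D}"
    and fin: "finite (crossing_set \<E> {A, B})" "finite (crossing_set \<E> {C, D})"
  shows "card (crossing_set \<E> {A \<inter> C, B \<union> D}) + card (crossing_set \<E> {B \<inter> D, A \<union> C})
       < card (crossing_set \<E> {A, B}) + card (crossing_set \<E> {C, D})"
    (is "card ?c + card ?d < card ?a + card ?b")
proof -
  have cross': "crosses {B, A} {D, C}"
    using cross by (simp add: insert_commute)
  \<comment> \<open>The count is by inclusion-exclusion: what crosses one of the two corners crosses
    \<open>{A, B}\<close> or \<open>{C, D}\<close>, and what crosses both corners crosses both
    separations.\<close>
  have union: "?c \<union> ?d \<subseteq> (?a \<union> ?b) - {{A, B}}"
  proof
    fix T assume T: "T \<in> ?c \<union> ?d"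
    then have "T \<in> \<Union>\<E>"
      by (auto simp: crossing_set_def)
    then obtain E F where EF: "T = {E, F}"
      by (rule separation_pairE[OF seps])
    have "\<not> (nested {A, B} T \<and> nested {C, D} T)"
      using T nested_corner[OF _ _ cross, of E F] nested_corner[OF _ _ cross', of E F]
      unfolding EF crossing_set_def crosses_def by (auto simp: insert_commute)
    moreover have "nested {A \<inter> C, B \<union> D} {A, B}" "nested {B \<inter> D, A \<union> C} {A, B}"
      unfolding nested_pair_iff by auto
    then have "T \<noteq> {A, B}"
      using T unfolding crossing_set_def crosses_def by blast
    ultimately show "T \<in> (?a \<union> ?b) - {{A, B}}"
      using \<open>T \<in> \<Union>\<E>\<close> unfolding crossing_set_def crosses_def by blast
  qed
  have inter: "?c \<inter> ?d \<subseteq> ?a \<inter> ?b"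
  proof
    fix T assume T: "T \<in> ?c \<inter> ?d"
    then have "T \<in> \<Union>\<E>"
      by (auto simp: crossing_set_def)
    then obtain E F where EF: "T = {E, F}"
      by (rule separation_pairE[OF seps])
    show "T \<in> ?a \<inter> ?b"
      using T nested_opposite_corners[of A B E F C D] nested_opposite_corners[of C D E F A B]
      unfolding EF crossing_set_def crosses_def by (auto simp: Int_commute Un_commute)
  qed
  have "{A, B} \<in> ?a \<union> ?b"
    using S crosses_sym[OF cross] by (auto simp: crossing_set_def)
  then have "?c \<union> ?d \<subset> ?a \<union> ?b"
    using union by blast
  then have "card (?c \<union> ?d) < card (?a \<union> ?b)"
    using fin by (intro psubset_card_mono) auto
  moreover have "card (?c \<inter> ?d) \<le> card (?a \<inter> ?b)"
    using fin inter by (intro card_mono) auto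
  moreover have "finite ?c" "finite ?d"
    using finite_subset[OF union] fin by auto
  ultimately show ?thesis
    using card_Un_Int[of ?c ?d] card_Un_Int[of ?a ?b] fin by linarith
qed

text \<open>The order is modular: the separators of the two corners have the same union and the same
  intersection as \<open>A \<inter> B\<close> and \<open>C \<inter> D\<close>.\<close>

lemma card_separator_opposite_corners:
  assumes "A \<union> B = V" "C \<union> D = V" "finite (A \<inter> B)" "finite (C \<inter> D)"
  shows "card (separator {A \<inter> C, B \<union> D}) + card (separator {B \<inter> D, A \<union> C})
       = card (A \<inter> B) + card (C \<inter> D)"
proof -
  let ?c = "separator {A \<inter> C, B \<union> D}" and ?d = "separator {B \<inter> D, A \<union> C}"
  have un: "?c \<union> ?d = (A \<inter> B) \<union> (C \<inter> D)" and int: "?c \<inter> ?d = (A \<inter> B) \<inter> (C \<inter> D)"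
    using assms(1,2) by auto
  have "finite ?c" "finite ?d"
    using un assms(3,4) by (metis finite_Un)+
  then show ?thesis
    using card_Un_Int[of ?c ?d] card_Un_Int[OF assms(3,4)] un int by simp
qed

lemma finite_separator_corner:
  assumes "finite (A \<inter> B)" "finite (C \<inter> D)"
  shows "finite (separator {A \<inter> C, B \<union> D})"
  by (rule finite_subset[of _ "(A \<inter> B) \<union> (C \<inter> D)"]) (use assms in auto)

text \<open>The entanglement axiom in natural numbers: on finite separators the comparison of
  cardinals is that of \<open>card\<close>.\<close>

lemma entanglement_side:
  assumes "entanglement G \<epsilon>" "{A, B} \<in> \<epsilon>" "separation G {C, D}" "crosses {A, B} {C, D}"
    and fin: "finite (A \<inter> B)" "finite (C \<inter> D)"
    and "card (separator {A \<inter> C, B \<union> D}) \<le> card (A \<inter> B)"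
    and "card (separator {A \<inter> D, B \<union> C}) \<le> card (A \<inter> B)"
  shows "card (separator {A \<inter> C, B \<union> D}) = card (A \<inter> B) \<and> {A \<inter> C, B \<union> D} \<in> \<epsilon> \<or>
         card (separator {A \<inter> D, B \<union> C}) = card (A \<inter> B) \<and> {A \<inter> D, B \<union> C} \<in> \<epsilon>"
proof -
  have fin': "finite (separator {A \<inter> C, B \<union> D})" "finite (separator {A \<inter> D, B \<union> C})"
    using fin finite_separator_corner[of A B C D] finite_separator_corner[of A B D C]
    by (simp_all add: Int_commute)
  have "separator {A \<inter> C, B \<union> D} \<lesssim> A \<inter> B" "separator {A \<inter> D, B \<union> C} \<lesssim> A \<inter> B"
    using assms(7,8) fin fin' by (simp_all only: lepoll_iff_card_le)
  then have "(separator {A \<inter> C, B \<union> D} \<approx> A \<inter> B \<and> {A \<inter> C, B \<union> D} \<in> \<epsilon>) \<or>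
        (separator {A \<inter> D, B \<union> C} \<approx> A \<inter> B \<and> {A \<inter> D, B \<union> C} \<in> \<epsilon>)"
    using assms(1-4) unfolding entanglement_def by blast
  then show ?thesis
    using fin fin' by (simp only: eqpoll_iff_card)
qed

text \<open>A corner in \<open>\<epsilon>\<close> whose opposite corner lies in
  \<open>\<delta>\<close> contradicts strict submodularity, since by minimality the two cross at
  least as many separations as \<open>S\<close> and \<open>T\<close> together. The axioms at all
  four sides force such a pair, or else one opposite pair inside \<open>\<epsilon>\<close> and the
  other inside \<open>\<delta>\<close>.\<close>

lemma no_crossing_minimal:
  assumes seps: "\<And>S. S \<in> \<Union>\<E> \<Longrightarrow> separation G S"
    and fin_sep: "\<And>S. S \<in> \<Union>\<E> \<Longrightarrow> finite (separator S)"
    and fin_cross: "\<And>S. S \<in> \<Union>\<E> \<Longrightarrow> finite (crossing_set \<E> S)"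
    and \<E>: "\<epsilon> \<in> \<E>" "\<delta> \<in> \<E>" "entanglement G \<epsilon>" "entanglement G \<delta>"
    and S: "S \<in> \<epsilon>" "\<And>U. U \<in> \<epsilon> \<Longrightarrow> card (crossing_set \<E> S) \<le> card (crossing_set \<E> U)"
    and T: "T \<in> \<delta>" "\<And>U. U \<in> \<delta> \<Longrightarrow> card (crossing_set \<E> T) \<le> card (crossing_set \<E> U)"
  shows "nested S T"
proof (rule ccontr)
  assume "\<not> nested S T"
  have in_\<E>: "S \<in> \<Union>\<E>" "T \<in> \<Union>\<E>"
    using \<E> S T by auto
  obtain A B where AB: "S = {A, B}" "A \<union> B = pverts G"
    using seps in_\<E> by (meson separation_pairE)
  obtain C D where CD: "T = {C, D}" "C \<union> D = pverts G"
    using seps in_\<E> by (meson separation_pairE)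
  have cross: "crosses {A, B} {C, D}"
    using \<open>\<not> nested S T\<close> AB CD by (simp add: crosses_def)
  have fin: "finite (A \<inter> B)" "finite (C \<inter> D)"
    using fin_sep in_\<E> AB CD by (metis separator_pair)+
  have finc: "finite (crossing_set \<E> {A, B})" "finite (crossing_set \<E> {C, D})"
    using fin_cross in_\<E> AB CD by metis+
  define ac ad bc bd where corners: "ac = {A \<inter> C, B \<union> D}" "ad = {A \<inter> D, B \<union> C}"
    "bc = {B \<inter> C, A \<union> D}" "bd = {B \<inter> D, A \<union> C}"
  define ord where "ord U = int (card (separator U))" for U :: "'a set set"
  define f where "f U = int (card (crossing_set \<E> U))" for U
  note swaps = Int_commute Un_commute insert_commute
  have sums: "ord ac + ord bd = ord S + ord T" "ord ad + ord bc = ord S + ord T"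
    using card_separator_opposite_corners[OF AB(2) CD(2) fin]
      card_separator_opposite_corners[of A B _ D C, OF AB(2)] CD(2) fin
    unfolding corners ord_def AB(1) CD(1) by (simp_all add: swaps flip: of_nat_add)
  have less: "f ac + f bd < f S + f T" "f ad + f bc < f S + f T"
    using card_crossing_set_opposite_corners[OF seps, of \<E> A B C D]
      card_crossing_set_opposite_corners[OF seps, of \<E> A B D C] in_\<E> cross finc
    unfolding corners f_def AB(1) CD(1) by (simp_all add: insert_commute flip: of_nat_add)
  have sep: "separation G {A, B}" "separation G {C, D}"
    using seps in_\<E> AB CD by blast+
  have S': "{A, B} \<in> \<epsilon>" and T': "{C, D} \<in> \<delta>"
    using S T AB CD by auto
  have sides:
    "ord ac \<le> ord S \<Longrightarrow> ord ad \<le> ord S \<Longrightarrow>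
       ord ac = ord S \<and> ac \<in> \<epsilon> \<or> ord ad = ord S \<and> ad \<in> \<epsilon>"
    "ord bc \<le> ord S \<Longrightarrow> ord bd \<le> ord S \<Longrightarrow>
       ord bc = ord S \<and> bc \<in> \<epsilon> \<or> ord bd = ord S \<and> bd \<in> \<epsilon>"
    "ord ac \<le> ord T \<Longrightarrow> ord bc \<le> ord T \<Longrightarrow>
       ord ac = ord T \<and> ac \<in> \<delta> \<or> ord bc = ord T \<and> bc \<in> \<delta>"
    "ord ad \<le> ord T \<Longrightarrow> ord bd \<le> ord T \<Longrightarrow>
       ord ad = ord T \<and> ad \<in> \<delta> \<or> ord bd = ord T \<and> bd \<in> \<delta>"
    using entanglement_side[OF \<E>(3) S' sep(2) cross fin]
      entanglement_side[of G \<epsilon> B A C D] entanglement_side[of G \<delta> C D A B]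
      entanglement_side[of G \<delta> D C A B] S' T' sep cross crosses_sym[OF cross] fin \<E>(3,4)
    unfolding corners ord_def AB(1) CD(1) by (simp_all only: separator_pair swaps simp_thms of_nat_le_iff of_nat_eq_iff)
  have min: "U \<in> \<epsilon> \<Longrightarrow> f S \<le> f U" "U \<in> \<delta> \<Longrightarrow> f T \<le> f U" for U
    using S(2) T(2) unfolding f_def by auto
  \<comment> \<open>By symmetry let \<open>ord S \<le> ord T\<close>. By \<open>sums\<close> and the
    axiom at \<open>T\<close>, some side of \<open>S\<close> has both corners of order at most
    \<open>ord S\<close>; say \<open>ac\<close> is the one that lies in \<open>\<epsilon>\<close>
    with order \<open>ord S\<close>, the other being \<open>ad\<close>. Then \<open>bd\<close> has
    order \<open>ord T\<close> and is not in \<open>\<delta>\<close>, so the axiom at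
    \<open>T\<close> puts \<open>ad\<close> into \<open>\<delta>\<close> with order
    \<open>ord T\<close>, and all orders are equal. Now \<open>bc\<close> is not in
    \<open>\<epsilon>\<close>, so \<open>bd\<close> is; hence \<open>ac\<close> is not in
    \<open>\<delta>\<close>, so \<open>bc\<close> is. The pair \<open>ac\<close>, \<open>bd\<close>
    gives \<open>f S < f T\<close>, the pair \<open>ad\<close>, \<open>bc\<close> gives
    \<open>f T < f S\<close>.\<close>
  show False
    using sums less sides min[of ac] min[of ad] min[of bc] min[of bd] by (smt (verit))
qed

section \<open>Deleting a set of vertices\<close>

text \<open>The reflexive transitive closure serves as reachability in \<open>G - X\<close>; it also
  relates every element of \<open>X\<close> to itself.\<close>

definition arcs_minus :: "'a pair_pre_digraph \<Rightarrow> 'a set \<Rightarrow> 'a rel" where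
  "arcs_minus G X = {(u, v) \<in> parcs G. u \<notin> X \<and> v \<notin> X}"

text \<open>The ordered form of \<open>separation\<close>, which keeps track of the sides.\<close>

definition separates :: "'a pair_pre_digraph \<Rightarrow> 'a set \<Rightarrow> 'a set \<Rightarrow> bool" where
  "separates G A B \<longleftrightarrow> A \<union> B = pverts G \<and> (\<forall>u \<in> A - B. \<forall>v \<in> B - A. (u, v) \<notin> parcs G)"

definition full_component :: "'a pair_pre_digraph \<Rightarrow> 'a set \<Rightarrow> 'a set \<Rightarrow> bool" where
  "full_component G X K \<longleftrightarrow> K \<in> components_minus G X \<and> neighbourhood G K = X"

text \<open>Inclusion-minimal separators of \<open>x\<close> and \<open>y\<close>, encoded by the
  standard characterisation through two full components; \<open>minimal_separator_eq\<close>
  recovers the minimality.\<close>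

definition minimal_separator :: "'a pair_pre_digraph \<Rightarrow> 'a \<Rightarrow> 'a \<Rightarrow> 'a set \<Rightarrow> bool" where
  "minimal_separator G x y X \<longleftrightarrow>
     (\<exists>K L. full_component G X K \<and> full_component G X L \<and> K \<inter> L = {} \<and> x \<in> K \<and> y \<in> L)"

lemma rtrancl_closed:
  assumes "(x, y) \<in> R\<^sup>*" "x \<in> Z" "\<And>u v. u \<in> Z \<Longrightarrow> (u, v) \<in> R \<Longrightarrow> v \<in> Z"
  shows "y \<in> Z"
  using assms by (induction rule: rtrancl_induct) auto

text \<open>\<open>P\<close> collects the ends of the arcs of a walk, which survives the deletion of
  any set that misses \<open>P\<close>.\<close>

lemma walk_finite_support:
  assumes "(x, y) \<in> (arcs_minus G X)\<^sup>*"
  shows "\<exists>P. finite P \<and> P \<inter> X = {} \<and> (\<forall>Y. P \<inter> Y = {} \<longrightarrow> (x, y) \<in> (arcs_minus G Y)\<^sup>*)"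
  using assms
proof (induction rule: rtrancl_induct)
  case base
  show ?case by (rule exI[of _ "{}"]) auto
next
  case (step y z)
  then obtain P where P: "finite P" "P \<inter> X = {}"
    "\<And>Y. P \<inter> Y = {} \<Longrightarrow> (x, y) \<in> (arcs_minus G Y)\<^sup>*" by blast
  have "(x, z) \<in> (arcs_minus G Y)\<^sup>*" if "(P \<union> {y, z}) \<inter> Y = {}" for Y
  proof -
    have "(x, y) \<in> (arcs_minus G Y)\<^sup>*" "(y, z) \<in> arcs_minus G Y"
      using P(3)[of Y] that step.hyps(2) by (auto simp: arcs_minus_def)
    then show ?thesis by (rule rtrancl_into_rtrancl)
  qed
  then show ?case
    using P(1,2) step.hyps(2) by (intro exI[of _ "P \<union> {y, z}"]) (auto simp: arcs_minus_def)
qed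

context pair_bidirected_digraph
begin

section \<open>Walks and components after deleting a vertex set\<close>

lemma sym_arcs_minus: "sym (arcs_minus G X)"
  using arcs_symmetric by (auto simp: sym_def arcs_minus_def)

lemma walk_sym: "(u, v) \<in> (arcs_minus G X)\<^sup>* \<Longrightarrow> (v, u) \<in> (arcs_minus G X)\<^sup>*"
  using sym_arcs_minus sym_rtrancl symD by metis

lemma separates_commute: "separates G A B \<Longrightarrow> separates G B A"
  unfolding separates_def using arcs_symmetric by blast

lemma separates_closed:
  assumes "separates G A B" "u \<in> A - B" "(u, v) \<in> parcs G"
  shows "v \<in> A"
  using assms in_arcsD2 unfolding separates_def by blast

lemma separates_walk:
  assumes "separates G A B" "u \<in> A - B" "(u, v) \<in> (arcs_minus G (A \<inter> B))\<^sup>*"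
  shows "v \<in> A - B"
  by (rule rtrancl_closed[OF assms(3,2)])
     (use separates_closed[OF assms(1)] in \<open>auto simp: arcs_minus_def\<close>)

text \<open>The interface to \<open>sccs_verts\<close>: later arguments use components only through
  these four facts.\<close>

lemma component:
  assumes "K \<in> components_minus G X"
  shows "K \<noteq> {}" and "K \<subseteq> pverts G - X"
    and "\<And>u v. u \<in> K \<Longrightarrow> v \<in> K \<Longrightarrow> (u, v) \<in> (arcs_minus G X)\<^sup>*"
    and "\<And>u v. u \<in> K \<Longrightarrow> (u, v) \<in> arcs_minus G X \<Longrightarrow> v \<in> K"
proof -
  let ?V = "pverts G - X"
  have ends: "arcs_ends (with_proj G \<restriction> ?V) = arcs_minus G X"
    using in_arcsD1 in_arcsD2 by (auto simp: arcs_ends_conv arcs_minus_def image_iff)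
  have reach: "(u \<rightarrow>\<^sup>*\<^bsub>with_proj G \<restriction> ?V\<^esub> v) \<longleftrightarrow> (u, v) \<in> rtrancl_on ?V (arcs_minus G X)" for u v
    unfolding reachable_def ends induce_subgraph_verts ..
  have K: "K \<noteq> {}" "\<And>u v. u \<in> K \<Longrightarrow> v \<in> K \<Longrightarrow> (u, v) \<in> rtrancl_on ?V (arcs_minus G X)"
    "\<And>u v. u \<in> K \<Longrightarrow> v \<notin> K \<Longrightarrow>
       (u, v) \<notin> rtrancl_on ?V (arcs_minus G X) \<or> (v, u) \<notin> rtrancl_on ?V (arcs_minus G X)"
    using assms unfolding components_minus_def pre_digraph.sccs_verts_def reach by blast+
  show "K \<noteq> {}" by (rule K(1))
  show sub: "K \<subseteq> ?V" using K(2) in_rtrancl_on_in_F by fast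
  show "(u, v) \<in> (arcs_minus G X)\<^sup>*" if "u \<in> K" "v \<in> K" for u v
    using K(2)[OF that] by (rule rtrancl_on_rtranclI)
  show "v \<in> K" if u: "u \<in> K" "(u, v) \<in> arcs_minus G X" for u v
  proof (rule ccontr)
    assume "v \<notin> K"
    \<comment> \<open>Maximality of a strongly connected component only forbids mutual reachability,
      so the reverse arc is needed as well.\<close>
    have "(v, u) \<in> arcs_minus G X" "u \<in> ?V" "v \<in> ?V"
      using u sub symD[OF sym_arcs_minus] in_arcsD2 by (auto simp: arcs_minus_def)
    then have "(u, v) \<in> rtrancl_on ?V (arcs_minus G X)" "(v, u) \<in> rtrancl_on ?V (arcs_minus G X)"
      using u by (meson rtrancl_on.intros)+
    then show False using K(3)[OF u(1) \<open>v \<notin> K\<close>] by blast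
  qed
qed

lemma component_walk:
  assumes "K \<in> components_minus G X" "u \<in> K" "(u, v) \<in> (arcs_minus G X)\<^sup>*"
  shows "v \<in> K"
  using rtrancl_closed[OF assms(3,2)] component(4)[OF assms(1)] by blast

text \<open>A walk in \<open>G - X\<close> that starts in \<open>K\<close> never leaves
  \<open>K\<close>, so it avoids every set disjoint from \<open>K\<close>.\<close>

lemma component_walk_inside:
  assumes K: "K \<in> components_minus G X" and "u \<in> K" "v \<in> K" and disj: "K \<inter> Y = {}"
  shows "(u, v) \<in> (arcs_minus G Y)\<^sup>*"
proof -
  have "v \<in> {w \<in> K. (u, w) \<in> (arcs_minus G Y)\<^sup>*}"
  proof (rule rtrancl_closed[OF component(3)[OF K \<open>u \<in> K\<close> \<open>v \<in> K\<close>]])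
    fix a b assume a: "a \<in> {w \<in> K. (u, w) \<in> (arcs_minus G Y)\<^sup>*}" and ab: "(a, b) \<in> arcs_minus G X"
    then have "b \<in> K" using component(4)[OF K] by blast
    moreover have "(a, b) \<in> arcs_minus G Y"
      using a ab \<open>b \<in> K\<close> disj by (auto simp: arcs_minus_def)
    ultimately show "b \<in> {w \<in> K. (u, w) \<in> (arcs_minus G Y)\<^sup>*}"
      using a by (auto intro: rtrancl_into_rtrancl)
  qed (use \<open>u \<in> K\<close> in auto)
  then show ?thesis by simp
qed

text \<open>Each vertex of \<open>X\<close> has a neighbour in the connected set \<open>K\<close>,
  so \<open>K\<close> links all of \<open>X - F\<close> as long as \<open>F\<close> misses
  \<open>K\<close>.\<close>

lemma full_component_walk:
  assumes K: "full_component G X K" and "F \<inter> K = {}" "u \<in> K \<union> (X - F)" "v \<in> K \<union> (X - F)"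
  shows "(u, v) \<in> (arcs_minus G F)\<^sup>*"
proof -
  have K': "K \<in> components_minus G X" "neighbourhood G K = X"
    using K by (auto simp: full_component_def)
  obtain k where k: "k \<in> K" using component(1)[OF K'(1)] by blast
  have "(k, w) \<in> (arcs_minus G F)\<^sup>*" if "w \<in> K \<union> (X - F)" for w
  proof (cases "w \<in> K")
    case True
    then show ?thesis using component_walk_inside[OF K'(1) k] assms(2) by blast
  next
    case False
    then have "w \<in> X - F" using that by blast
    then obtain a where a: "a \<in> K" "(a, w) \<in> parcs G"
      using K'(2) by (auto simp: neighbourhood_def)
    then have "(k, a) \<in> (arcs_minus G F)\<^sup>*" "(a, w) \<in> arcs_minus G F"
      using component_walk_inside[OF K'(1) k, of a F] assms(2) \<open>w \<in> X - F\<close>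
      by (auto simp: arcs_minus_def)
    then show ?thesis by (rule rtrancl_into_rtrancl)
  qed
  then show ?thesis using assms(3,4) walk_sym rtrancl_trans by meson
qed

section \<open>Minimal separators of bounded size\<close>

lemma minimal_separator_not_walk:
  assumes "minimal_separator G x y X"
  shows "(x, y) \<notin> (arcs_minus G X)\<^sup>*"
  using assms component_walk unfolding minimal_separator_def full_component_def by blast

text \<open>A vertex \<open>z\<close> of \<open>X - F\<close> would be joined to \<open>x\<close>
  through one full component and to \<open>y\<close> through the other, both avoiding
  \<open>F\<close>.\<close>

lemma minimal_separator_eq:
  assumes "minimal_separator G x y X" "F \<subseteq> X" "(x, y) \<notin> (arcs_minus G F)\<^sup>*"
  shows "X = F"
proof (rule ccontr)
  assume "X \<noteq> F"
  then obtain z where z: "z \<in> X - F" using assms(2) by blast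
  obtain K L where KL: "full_component G X K" "full_component G X L" "x \<in> K" "y \<in> L"
    using assms(1) unfolding minimal_separator_def by blast
  have disj: "F \<inter> K = {}" "F \<inter> L = {}"
    using KL(1,2) component(2) assms(2) unfolding full_component_def by blast+
  have "(x, z) \<in> (arcs_minus G F)\<^sup>*" "(z, y) \<in> (arcs_minus G F)\<^sup>*"
    using full_component_walk[OF KL(1) disj(1)] full_component_walk[OF KL(2) disj(2)] KL(3,4) z
    by blast+
  then show False using assms(3) by (meson rtrancl_trans)
qed

text \<open>A bounded search tree: \<open>F\<close> is the part of \<open>X\<close> already chosen
  and \<open>k\<close> bounds the number of vertices still to come. If some walk from
  \<open>x\<close> to \<open>y\<close> avoids \<open>F\<close>, then \<open>X\<close> must contain
  one of its finitely many support vertices, on which the search branches; otherwise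
  \<open>X = F\<close> by minimality.\<close>

lemma finite_minimal_separators_superset:
  "finite {X. F \<subseteq> X \<and> finite X \<and> card (X - F) \<le> k \<and> minimal_separator G x y X}"
    (is "finite (?M k F)")
proof (induction k arbitrary: F)
  case 0
  \<comment> \<open>Finiteness of \<open>X\<close> matters here, because \<open>card\<close> is
    \<open>0\<close> on infinite sets.\<close>
  have "?M 0 F \<subseteq> {F}" by auto
  then show ?case by (rule finite_subset) simp
next
  case (Suc k)
  show ?case
  proof (cases "(x, y) \<in> (arcs_minus G F)\<^sup>*")
    case False
    then have "?M (Suc k) F \<subseteq> {F}" using minimal_separator_eq by blast
    then show ?thesis by (rule finite_subset) simp
  next
    case True
    then obtain P where P: "finite P" "P \<inter> F = {}"
      "\<And>Y. P \<inter> Y = {} \<Longrightarrow> (x, y) \<in> (arcs_minus G Y)\<^sup>*"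
      using walk_finite_support by metis
    have "?M (Suc k) F \<subseteq> (\<Union>p\<in>P. ?M k (insert p F))"
    proof
      fix X assume X: "X \<in> ?M (Suc k) F"
      then have "P \<inter> X \<noteq> {}" using P(3) minimal_separator_not_walk by blast
      then obtain p where p: "p \<in> P" "p \<in> X" "p \<notin> F" using P(2) by blast
      have "X - F = insert p (X - insert p F)" using p by blast
      then have "card (X - F) = Suc (card (X - insert p F))"
        using X by (metis (no_types, lifting) card_insert_disjoint Diff_iff finite_Diff insertI1 mem_Collect_eq)
      then show "X \<in> (\<Union>p\<in>P. ?M k (insert p F))" using X p by auto
    qed
    then show ?thesis by (rule finite_subset) (use P(1) Suc in blast)
  qed
qed

lemma finite_minimal_separators:
  "finite {X. finite X \<and> card X \<le> k \<and> minimal_separator G x y X}"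
  using finite_minimal_separators_superset[of "{}" k x y] by simp

section \<open>Local finiteness, connectedness and separations with a given separator\<close>

lemma finite_neighbours:
  assumes "locally_finite G"
  shows "finite {w. (v, w) \<in> parcs G}"
proof (cases "v \<in> pverts G")
  case True
  then have "finite (snd ` out_arcs G v)" using assms by (auto simp: locally_finite_def)
  moreover have "{w. (v, w) \<in> parcs G} \<subseteq> snd ` out_arcs G v"
    by (force simp: out_arcs_def)
  ultimately show ?thesis by (rule finite_subset[rotated])
next
  case False
  then have "{w. (v, w) \<in> parcs G} = {}" using in_arcsD1 by blast
  then show ?thesis by simp
qed

lemma connected_walk:
  assumes "Digraph_Component.connected G" "u \<in> pverts G" "v \<in> pverts G"
  shows "(u, v) \<in> (parcs G)\<^sup>*"
proof -
  have "strongly_connected (with_proj G)"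
    using assms(1) symmetric_connected_imp_strongly_connected[OF sym_arcs] by simp
  then have "u \<rightarrow>\<^sup>*\<^bsub>with_proj G\<^esub> v" using assms(2,3) unfolding strongly_connected_def by simp
  then show ?thesis using reachable_rtranclI by force
qed

lemma connected_closed:
  assumes "Digraph_Component.connected G" "z \<in> Z" "z \<in> pverts G" "v \<in> pverts G"
    and "\<And>u w. u \<in> Z \<Longrightarrow> (u, w) \<in> parcs G \<Longrightarrow> w \<in> Z"
  shows "v \<in> Z"
  using rtrancl_closed[OF connected_walk[OF assms(1,3,4)] assms(2)] assms(5) by blast

text \<open>Beyond \<open>X\<close>, a side is a union of components of \<open>G - X\<close>, and by
  connectedness each of them contains a neighbour of \<open>X\<close>. So a side is determined by
  the neighbours of \<open>X\<close> it contains outside \<open>X\<close>, and local finiteness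
  leaves finitely many choices.\<close>

lemma finite_separations_of_separator:
  assumes conn: "Digraph_Component.connected G" and lf: "locally_finite G" and "finite X"
  shows "finite {S. proper_separation G S \<and> separator S = X}"
proof -
  let ?N = "\<Union>x\<in>X. {w. (x, w) \<in> parcs G}"
  let ?side = "\<lambda>W. X \<union> {v. \<exists>w \<in> W. (w, v) \<in> (arcs_minus G X)\<^sup>*}"
  have side: "A = ?side (?N \<inter> (A - B))"
    if AB: "separates G A B" "A \<inter> B = X" "B - A \<noteq> {}" for A B
  proof
    show "?side (?N \<inter> (A - B)) \<subseteq> A"
      using AB separates_walk[OF AB(1)] by blast
    show "A \<subseteq> ?side (?N \<inter> (A - B))"
    proof
      fix a assume a: "a \<in> A"
      show "a \<in> ?side (?N \<inter> (A - B))"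
      proof (rule ccontr)
        assume not: "a \<notin> ?side (?N \<inter> (A - B))"
        obtain b where b: "b \<in> B - A" using AB(3) by blast
        \<comment> \<open>If no vertex reachable from \<open>a\<close> in \<open>G - X\<close> were
          adjacent to \<open>X\<close>, this set would be closed under arcs of \<open>G\<close> and
          would reach \<open>b\<close> on the other side.\<close>
        let ?Z = "{z \<in> A - B. (z, a) \<in> (arcs_minus G X)\<^sup>*}"
        have "b \<in> ?Z"
        proof (rule connected_closed[OF conn])
          show "a \<in> ?Z" using a not AB(2) by auto
          show "a \<in> pverts G" "b \<in> pverts G" using a b AB(1) by (auto simp: separates_def)
        next
          fix u w assume u: "u \<in> ?Z" and uw: "(u, w) \<in> parcs G"
          have "w \<in> A" using separates_closed[OF AB(1) _ uw] u by blast
          have wu: "(w, u) \<in> parcs G" using arcs_symmetric[OF uw] .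
          have "w \<notin> X"
          proof
            assume "w \<in> X"
            then have "u \<in> ?N \<inter> (A - B)" using u wu by blast
            then show False using not u by blast
          qed
          then have "(w, u) \<in> arcs_minus G X" using wu u AB(2) by (auto simp: arcs_minus_def)
          then show "w \<in> ?Z"
            using u \<open>w \<in> A\<close> \<open>w \<notin> X\<close> AB(2) by (auto intro: converse_rtrancl_into_rtrancl)
        qed
        then show False using b by blast
      qed
    qed
  qed
  have "{S. proper_separation G S \<and> separator S = X} \<subseteq> (\<lambda>(U, W). {?side U, ?side W}) ` (Pow ?N \<times> Pow ?N)"
  proof
    fix S assume "S \<in> {S. proper_separation G S \<and> separator S = X}"
    then have S: "proper_separation G S" "separator S = X" by auto
    obtain A B where AB: "S = {A, B}" "separates G A B"
      using S(1) unfolding proper_separation_def separation_def separates_def by blast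
    have ne: "A - B \<noteq> {}" "B - A \<noteq> {}"
      using S(1) unfolding AB(1) proper_separation_def by (auto simp: doubleton_eq_iff)
    have X: "A \<inter> B = X" "B \<inter> A = X" using S(2) AB(1) by auto
    have "S = {?side (?N \<inter> (A - B)), ?side (?N \<inter> (B - A))}"
      using side[OF AB(2) X(1) ne(2)] side[OF separates_commute[OF AB(2)] X(2) ne(1)] AB(1) by simp
    then show "S \<in> (\<lambda>(U, W). {?side U, ?side W}) ` (Pow ?N \<times> Pow ?N)" by blast
  qed
  moreover have "finite (Pow ?N \<times> Pow ?N)"
    using assms(3) finite_neighbours[OF lf] by blast
  ultimately show ?thesis by (rule finite_subset[OF _ finite_imageI])
qed

section \<open>Tight separations\<close>

lemma tight_separationE:
  assumes "tight_separation G S"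
  obtains A B K L where "S = {A, B}" "separates G A B"
    "full_component G (A \<inter> B) K" "K \<subseteq> A - B" "full_component G (A \<inter> B) L" "L \<subseteq> B - A"
proof -
  obtain A B K L where *: "S = {A, B}" "full_component G (A \<inter> B) K" "K \<subseteq> A - B"
    "full_component G (A \<inter> B) L" "L \<subseteq> B - A" "separation G S"
    using assms unfolding tight_separation_def full_component_def by blast
  obtain A' B' where "S = {A', B'}" "separates G A' B'"
    using *(6) unfolding separation_def separates_def by blast
  then have "separates G A B" using *(1) separates_commute by (auto simp: doubleton_eq_iff)
  then show thesis using * that by blast
qed

text \<open>The set \<open>(C - D) \<inter> (B - A)\<close> is closed under arcs: a neighbour lies
  in \<open>C \<inter> B\<close>, and the positions of the separators keep it out of
  \<open>D\<close> and \<open>A\<close>. As it misses \<open>A - B\<close>, connectedness makes it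
  empty.\<close>

lemma nested_if_disjoint_separators:
  assumes conn: "Digraph_Component.connected G"
    and AB: "separates G A B" "A - B \<noteq> {}" and CD: "separates G C D"
    and "C \<inter> D \<subseteq> A - B" "A \<inter> B \<subseteq> D - C"
  shows "C \<subseteq> A" "B \<subseteq> D"
proof -
  have "(C - D) \<inter> (B - A) = {}"
  proof (rule ccontr)
    assume "(C - D) \<inter> (B - A) \<noteq> {}"
    then obtain z where z: "z \<in> (C - D) \<inter> (B - A)" by blast
    obtain a where a: "a \<in> A - B" using AB(2) by blast
    have "a \<in> (C - D) \<inter> (B - A)"
    proof (rule connected_closed[OF conn z])
      show "z \<in> pverts G" "a \<in> pverts G" using z a AB(1) by (auto simp: separates_def)
    next
      fix u w assume u: "u \<in> (C - D) \<inter> (B - A)" and uw: "(u, w) \<in> parcs G"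
      have "w \<in> C" "w \<in> B"
        using separates_closed[OF CD _ uw] separates_closed[OF separates_commute[OF AB(1)] _ uw] u
        by blast+
      then show "w \<in> (C - D) \<inter> (B - A)" using assms(5,6) by blast
    qed
    then show False using a by blast
  qed
  then show "C \<subseteq> A" "B \<subseteq> D"
    using assms(5,6) AB(1) CD unfolding separates_def by blast+
qed

lemma connected_set_one_side:
  assumes AB: "separates G A B" and "\<And>u v. u \<in> Z \<Longrightarrow> v \<in> Z \<Longrightarrow> (u, v) \<in> (arcs_minus G (A \<inter> B))\<^sup>*"
    and "Z \<inter> (A \<inter> B) = {}" "Z \<subseteq> pverts G"
  shows "Z \<subseteq> A - B \<or> Z \<subseteq> B - A"
proof (cases "Z \<inter> (A - B) = {}")
  case True
  then show ?thesis using assms(3,4) AB unfolding separates_def by blast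
next
  case False
  then obtain u where "u \<in> Z" "u \<in> A - B" by blast
  then have "Z \<subseteq> A - B" using separates_walk[OF AB] assms(2) by blast
  then show ?thesis ..
qed

text \<open>The vertices of \<open>X\<close> are joined through \<open>M\<close>, which misses
  \<open>C \<inter> D\<close>.\<close>

lemma full_component_one_side:
  assumes CD: "separates G C D" and M: "full_component G X M" and "M \<inter> (C \<inter> D) = {}" "X \<inter> (C \<inter> D) = {}"
  shows "X \<subseteq> C - D \<or> X \<subseteq> D - C"
proof (rule connected_set_one_side[OF CD])
  show "(u, v) \<in> (arcs_minus G (C \<inter> D))\<^sup>*" if "u \<in> X" "v \<in> X" for u v
    by (rule full_component_walk[OF M]) (use assms(3,4) that in auto)
  show "X \<subseteq> pverts G" using M unfolding full_component_def neighbourhood_def by blast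
qed (rule assms(4))

text \<open>
  If the full component \<open>K\<close> avoids \<open>A \<inter> B\<close>, then \<open>C \<inter> D\<close> lies on one side of \<open>{A, B}\<close>, so the full
  component on the other side avoids \<open>C \<inter> D\<close>, and \<open>A \<inter> B\<close> lies on one side of \<open>{C, D}\<close>.
\<close>

lemma nested_if_full_component_disjoint:
  assumes conn: "Digraph_Component.connected G"
    and AB: "separates G A B" "full_component G (A \<inter> B) M" "M \<subseteq> A - B"
      "full_component G (A \<inter> B) N" "N \<subseteq> B - A"
    and CD: "separates G C D" "full_component G (C \<inter> D) K"
    and disj: "(A \<inter> B) \<inter> (C \<inter> D) = {}" "K \<inter> (A \<inter> B) = {}"
  shows "nested {A, B} {C, D}"
proof -
  have "M \<noteq> {}" "N \<noteq> {}"
    using component(1)[of M "A \<inter> B"] component(1)[of N "A \<inter> B"] AB(2,4)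
    by (simp_all add: full_component_def)
  then have ne: "A - B \<noteq> {}" "B - A \<noteq> {}"
    using AB(3,5) by blast+
  have Y: "C \<inter> D \<subseteq> A - B \<or> C \<inter> D \<subseteq> B - A"
    by (rule full_component_one_side[OF AB(1) CD(2) disj(2)]) (use disj in blast)
  then have "M \<inter> (C \<inter> D) = {} \<or> N \<inter> (C \<inter> D) = {}" using AB(3,5) by blast
  then have X: "A \<inter> B \<subseteq> C - D \<or> A \<inter> B \<subseteq> D - C"
    using full_component_one_side[OF CD(1) AB(2)] full_component_one_side[OF CD(1) AB(4)] disj(1)
    by blast
  note BA = separates_commute[OF AB(1)] and DC = separates_commute[OF CD(1)]
  have comm: "B \<inter> A = A \<inter> B" "D \<inter> C = C \<inter> D" by auto
  \<comment> \<open>The four cases are one case up to renaming the sides.\<close>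
  show ?thesis
    using Y X
  proof (elim disjE)
    assume "C \<inter> D \<subseteq> A - B" "A \<inter> B \<subseteq> C - D"
    then show ?thesis
      using nested_if_disjoint_separators[OF conn AB(1) ne(1) DC]
      unfolding nested_pair_iff comm by simp
  next
    assume "C \<inter> D \<subseteq> A - B" "A \<inter> B \<subseteq> D - C"
    then show ?thesis
      using nested_if_disjoint_separators[OF conn AB(1) ne(1) CD(1)]
      unfolding nested_pair_iff by simp
  next
    assume "C \<inter> D \<subseteq> B - A" "A \<inter> B \<subseteq> C - D"
    then show ?thesis
      using nested_if_disjoint_separators[OF conn BA ne(2) DC]
      unfolding nested_pair_iff comm by simp
  next
    assume "C \<inter> D \<subseteq> B - A" "A \<inter> B \<subseteq> D - C"
    then show ?thesis
      using nested_if_disjoint_separators[OF conn BA ne(2) CD(1)]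
      unfolding nested_pair_iff comm by simp
  qed
qed

section \<open>Finiteness of crossing sets\<close>

text \<open>If the separators are disjoint, both full components of \<open>T\<close> meet the
  separator of \<open>S\<close>, or else \<open>S\<close> and \<open>T\<close> would be nested;
  \<open>x\<close> and \<open>y\<close> are taken there. Otherwise a common vertex of the separators
  has a neighbour in each full component of \<open>T\<close>.\<close>

lemma crossing_tight_minimal_separator:
  assumes conn: "Digraph_Component.connected G"
    and S: "tight_separation G S" and T: "tight_separation G T" and cross: "crosses S T"
  shows "\<exists>x y. {x, y} \<subseteq> separator S \<union> (\<Union>v\<in>separator S. {w. (v, w) \<in> parcs G}) \<and>
    minimal_separator G x y (separator T)"
proof -
  obtain A B M N where AB: "S = {A, B}" "separates G A B"
    "full_component G (A \<inter> B) M" "M \<subseteq> A - B" "full_component G (A \<inter> B) N" "N \<subseteq> B - A"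
    using S by (rule tight_separationE)
  obtain C D K L where CD: "T = {C, D}" "separates G C D"
    "full_component G (C \<inter> D) K" "K \<subseteq> C - D" "full_component G (C \<inter> D) L" "L \<subseteq> D - C"
    using T by (rule tight_separationE)
  have min: "minimal_separator G x y (C \<inter> D)" if "x \<in> K" "y \<in> L" for x y
    using CD that unfolding minimal_separator_def by blast
  show ?thesis
  proof (cases "(A \<inter> B) \<inter> (C \<inter> D) = {}")
    case True
    have "K \<inter> (A \<inter> B) \<noteq> {}" "L \<inter> (A \<inter> B) \<noteq> {}"
      using nested_if_full_component_disjoint[OF conn AB(2-6) CD(2,3) True]
        nested_if_full_component_disjoint[OF conn AB(2-6) CD(2,5) True] cross
      unfolding crosses_def AB(1) CD(1) by blast+
    then obtain x y where "x \<in> K" "x \<in> A \<inter> B" "y \<in> L" "y \<in> A \<inter> B" by blast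
    then have "{x, y} \<subseteq> A \<inter> B" "minimal_separator G x y (C \<inter> D)" using min by auto
    then show ?thesis unfolding AB(1) CD(1) separator_pair by blast
  next
    case False
    then obtain v where v: "v \<in> A \<inter> B" "v \<in> C \<inter> D" by blast
    then obtain x y where "x \<in> K" "(x, v) \<in> parcs G" "y \<in> L" "(y, v) \<in> parcs G"
      using CD(3,5) unfolding full_component_def neighbourhood_def by blast
    then have "minimal_separator G x y (C \<inter> D)" "(v, x) \<in> parcs G" "(v, y) \<in> parcs G"
      using min arcs_symmetric by auto
    then show ?thesis using v(1) unfolding AB(1) CD(1) separator_pair by blast
  qed
qed

text \<open>There are finitely many choices for the pair \<open>x\<close>, \<open>y\<close> near the
  separator of \<open>S\<close>, for each pair finitely many minimal separators of size at most
  \<open>k\<close>, and for each of these finitely many proper separations.\<close>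

lemma finite_tight_separations_crossing:
  assumes conn: "Digraph_Component.connected G" and lf: "locally_finite G"
    and S: "tight_separation G S" "finite (separator S)"
  shows "finite {T. tight_separation G T \<and> proper_separation G T \<and> finite (separator T) \<and>
    card (separator T) \<le> k \<and> crosses S T}" (is "finite ?\<T>")
proof -
  define W where "W = separator S \<union> (\<Union>v\<in>separator S. {w. (v, w) \<in> parcs G})"
  define \<X> where "\<X> = (\<Union>x\<in>W. \<Union>y\<in>W. {X. finite X \<and> card X \<le> k \<and> minimal_separator G x y X})"
  have "finite W" unfolding W_def using S(2) finite_neighbours[OF lf] by blast
  then have "finite \<X>" unfolding \<X>_def using finite_minimal_separators by blast
  then have "finite (\<Union>X\<in>\<X>. {T. proper_separation G T \<and> separator T = X})"
    using finite_separations_of_separator[OF conn lf] unfolding \<X>_def by blast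
  moreover have "?\<T> \<subseteq> (\<Union>X\<in>\<X>. {T. proper_separation G T \<and> separator T = X})"
  proof
    fix T assume T: "T \<in> ?\<T>"
    then obtain x y where "{x, y} \<subseteq> W" "minimal_separator G x y (separator T)"
      using crossing_tight_minimal_separator[OF conn S(1), of T] unfolding W_def by blast
    then show "T \<in> (\<Union>X\<in>\<X>. {T. proper_separation G T \<and> separator T = X})"
      using T unfolding \<X>_def by blast
  qed
  ultimately show ?thesis by (rule finite_subset[rotated])
qed

end

section \<open>Nestedness of the friendly separations\<close>

theorem theorem4p2:
  fixes G :: "'a pair_pre_digraph" and \<E> :: "'a set set set set"
  assumes "pair_bidirected_digraph G"
    and "locally_finite G"
    and "Digraph_Component.connected G"
    and "finitely_bounded \<E>"
    and "\<And>\<epsilon>. \<epsilon> \<in> \<E> \<Longrightarrow> tight_entanglement G \<epsilon>"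
  shows "pairwise nested {S. friendly \<E> S}"
proof -
  interpret pair_bidirected_digraph G by fact
  obtain k where k: "\<And>S. S \<in> \<Union>\<E> \<Longrightarrow> finite (separator S) \<and> card (separator S) \<le> k"
    using assms(4) unfolding finitely_bounded_def by blast
  have ent: "entanglement G \<epsilon>" if "\<epsilon> \<in> \<E>" for \<epsilon>
    using assms(5)[OF that] by (simp add: tight_entanglement_def)
  have tight: "tight_separation G S" "proper_separation G S" "separation G S" if "S \<in> \<Union>\<E>" for S
  proof -
    obtain \<epsilon> where "\<epsilon> \<in> \<E>" "S \<in> \<epsilon>" using \<open>S \<in> \<Union>\<E>\<close> by blast
    then show "tight_separation G S" "proper_separation G S"
      using assms(5) ent by (auto simp: tight_entanglement_def entanglement_def)
    then show "separation G S" by (simp add: proper_separation_def)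
  qed
  have fin: "finite (crossing_set \<E> S)" if "S \<in> \<Union>\<E>" for S
  proof (rule finite_subset)
    show "finite {T. tight_separation G T \<and> proper_separation G T \<and> finite (separator T) \<and>
      card (separator T) \<le> k \<and> crosses S T}"
      using k[OF that] tight(1)[OF that] assms(2,3) by (intro finite_tight_separations_crossing) auto
    show "crossing_set \<E> S \<subseteq> {T. tight_separation G T \<and> proper_separation G T \<and>
      finite (separator T) \<and> card (separator T) \<le> k \<and> crosses S T}"
    proof
      fix T assume "T \<in> crossing_set \<E> S"
      then have "T \<in> \<Union>\<E>" "crosses S T" by (simp_all add: crossing_set_def)
      then show "T \<in> {T. tight_separation G T \<and> proper_separation G T \<and>
          finite (separator T) \<and> card (separator T) \<le> k \<and> crosses S T}"
        using k[of T] tight(1,2)[of T] by simp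
    qed
  qed
  \<comment> \<open>As the crossing sets are finite, having none of strictly smaller cardinality
    means that \<open>card\<close> is minimal.\<close>
  have min: "\<exists>\<epsilon> \<in> \<E>. S \<in> \<epsilon> \<and> (\<forall>U \<in> \<epsilon>. card (crossing_set \<E> S) \<le> card (crossing_set \<E> U))"
    if friendly: "friendly \<E> S" for S
  proof -
    obtain \<epsilon> where \<epsilon>: "\<epsilon> \<in> \<E>" "S \<in> \<epsilon>" "\<And>U. U \<in> \<epsilon> \<Longrightarrow> \<not> crossing_set \<E> U \<prec> crossing_set \<E> S"
      using friendly unfolding friendly_def by blast
    have "card (crossing_set \<E> S) \<le> card (crossing_set \<E> U)" if "U \<in> \<epsilon>" for U
    proof -
      have "finite (crossing_set \<E> S)" "finite (crossing_set \<E> U)"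
        using fin \<epsilon>(1,2) that by (meson UnionI)+
      then show ?thesis
        using \<epsilon>(3)[OF that] by (auto simp: lesspoll_def lepoll_iff_card_le eqpoll_iff_card)
    qed
    then show ?thesis using \<epsilon> by blast
  qed
  show ?thesis
  proof (rule pairwiseI)
    fix S T assume "S \<in> {S. friendly \<E> S}" "T \<in> {S. friendly \<E> S}"
    then have "friendly \<E> S" "friendly \<E> T" by simp_all
    then obtain \<epsilon> \<delta> where "\<epsilon> \<in> \<E>" "\<delta> \<in> \<E>" "S \<in> \<epsilon>" "T \<in> \<delta>"
      "\<And>U. U \<in> \<epsilon> \<Longrightarrow> card (crossing_set \<E> S) \<le> card (crossing_set \<E> U)"
      "\<And>U. U \<in> \<delta> \<Longrightarrow> card (crossing_set \<E> T) \<le> card (crossing_set \<E> U)"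
      using min by meson
    then show "nested S T"
      by (intro no_crossing_minimal[of \<E> G \<epsilon> \<delta> S T]) (use tight(3) k fin ent in auto)
  qed
qed

end
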